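(* For every integer $i\ge 1$ there exists an integer $M$ (depending only on $i$) such that the following holds for every odd integer $m\ge M$ with $\gcd(i,m)=1$. Put $q=2^i$, let $a_1,a_2,a_3,a_4\in\mathbb{F}_{2^m}$, and let $G_{a_1,a_2,a_3,a_4}:\mathbb{F}_{2^m}^3\to\mathbb{F}_{2^m}^3$ be the function $$G_{a_1,a_2,a_3,a_4}(x,y,z)=\big(x^{q+1}+a_1x^qz+a_2yz^q,\ \ x^qz+y^{q+1},\ \ a_3xy^q+a_4y^qz+z^{q+1}\big).$$ If $a_2a_3\neq0$ and the polynomial $$a_2^{q+1}a_3^q\,T^{q^2+q+1}+a_2^qa_4^q\,T^{q^2+q}+1$$ has a root in $\mathbb{F}_{2^m}$, then $G_{a_1,a_2,a_3,a_4}$ is not a permutation of $\mathbb{F}_{2^m}^3$.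
   Context: A function $\mathbb{F}_{2^m}^3\to\mathbb{F}_{2^m}^3$ is called a permutation if it is bijective. *)

theory Defs
  imports "HOL-Library.Z2" "HOL-Algebra.Algebraic_Closure_Type"
begin

text \<open>
  All the fields of order \<open>2 ^ m\<close> are realised inside one fixed algebraic closure of the field
  with two elements.  A single type is needed because the bound \<open>M\<close> of the theorem
  is chosen before \<open>m\<close>, and hence before the field: a field given by a type variable would be
  fixed first.
\<close>

type_synonym F2bar = "bit alg_closure"

text \<open>
  The unique subfield of order \<open>2 ^ m\<close> (for \<open>m \<ge> 1\<close>): the fixed points of the \<open>m\<close>-th
  power of the Frobenius map.  That this is a subfield with \<open>2 ^ m\<close> elements, and the only one,
  is proved below.
\<close>

definition GF2 :: "nat \<Rightarrow> F2bar set" where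
  "GF2 m = {x. x ^ (2 ^ m) = x}"

lemma CHAR_bit [simp]: "CHAR(bit) = 2"
proof (rule CHAR_eq_posI)
  show "(2::nat) > 0" by simp
  show "of_nat 2 = (0 :: bit)" by simp
  show "of_nat x \<noteq> (0 :: bit)" if "x > 0" "x < 2" for x :: nat
  proof -
    from that have "x = 1" by linarith
    then show ?thesis by simp
  qed
qed

lemma CHAR_F2bar: "CHAR(F2bar) = 2"
  by simp

lemma F2bar_add_power: "(x + y :: F2bar) ^ (2 ^ m) = x ^ (2 ^ m) + y ^ (2 ^ m)"
  by (rule freshmans_dream'[where n = m]) simp_all

lemma GF2_0 [simp]: "0 \<in> GF2 m"
  by (simp add: GF2_def)

lemma GF2_1 [simp]: "1 \<in> GF2 m"
  by (simp add: GF2_def)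

lemma GF2_add: "x \<in> GF2 m \<Longrightarrow> y \<in> GF2 m \<Longrightarrow> x + y \<in> GF2 m"
  by (simp add: GF2_def F2bar_add_power)

lemma GF2_uminus: "x \<in> GF2 m \<Longrightarrow> - x \<in> GF2 m"
  by (simp only: uminus_CHAR_2[OF CHAR_F2bar])

lemma GF2_mult: "x \<in> GF2 m \<Longrightarrow> y \<in> GF2 m \<Longrightarrow> x * y \<in> GF2 m"
  by (simp add: GF2_def power_mult_distrib)

lemma GF2_inverse: "x \<in> GF2 m \<Longrightarrow> inverse x \<in> GF2 m"
  by (simp add: GF2_def power_inverse)

lemma GF2_power: "x \<in> GF2 m \<Longrightarrow> x ^ n \<in> GF2 m"
  by (induction n) (simp_all add: GF2_mult)

lemma card_GF2:
  assumes "m \<ge> 1"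
  shows "card (GF2 m) = 2 ^ m"
proof -
  define n :: nat where "n = 2 ^ m"
  have n: "n \<ge> 2" "even n"
    using assms self_le_power[of "2::nat" m] by (auto simp: n_def)
  define p :: "F2bar poly" where
    "p = Polynomial.monom 1 n - Polynomial.monom 1 1"
  have deg: "Polynomial.degree p = n"
  proof -
    have "Polynomial.degree (Polynomial.monom (1::F2bar) 1)
        < Polynomial.degree (Polynomial.monom (1::F2bar) n)"
      using n by (simp add: Polynomial.degree_monom_eq)
    then show ?thesis
      using degree_add_eq_left[of "- Polynomial.monom (1::F2bar) 1" "Polynomial.monom 1 n"]
      by (simp add: p_def Polynomial.degree_monom_eq)
  qed
  then have "p \<noteq> 0" using n by auto
  have "(of_nat n :: F2bar) = 0"
    using n(2) by (simp add: of_nat_eq_0_iff_char_dvd)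
  then have pd: "pderiv p = - 1"
    by (simp add: p_def pderiv_diff pderiv_monom monom_0 one_pCons)
  obtain A where A: "size A = Polynomial.degree p"
      "p = Polynomial.smult (Polynomial.lead_coeff p) (\<Prod>x\<in>#A. [:- x, 1:])"
    using alg_closed_imp_factorization[OF \<open>p \<noteq> 0\<close>] by metis
  have roots: "set_mset A = GF2 m"
  proof -
    have "x \<in># A \<longleftrightarrow> poly p x = 0" for x
      by (subst A(2)) (use \<open>p \<noteq> 0\<close> in
        \<open>auto simp: poly_prod_mset prod_mset_zero_iff image_iff\<close>)
    moreover have "poly p x = 0 \<longleftrightarrow> x \<in> GF2 m" for x
      by (simp add: p_def poly_monom GF2_def n_def)
    ultimately show ?thesis by blast
  qed
  have "count A x = 1" if x: "x \<in># A" for x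
  proof (rule ccontr)
    assume "count A x \<noteq> 1"
    obtain C where C: "A = add_mset x C"
      using multi_member_split[OF x] by blast
    with \<open>count A x \<noteq> 1\<close> have "x \<in># C" by (simp add: count_eq_zero_iff)
    then obtain B where B: "A = add_mset x (add_mset x B)"
      using C multi_member_split[of x C] by blast
    define q where "q = Polynomial.smult (Polynomial.lead_coeff p) (\<Prod>x\<in>#B. [:- x, 1:])"
    have "p = [:- x, 1:] * ([:- x, 1:] * q)"
      by (subst A(2)) (simp only: B q_def image_mset_add_mset prod_mset.add_mset
          mult_smult_right)
    then have "poly (pderiv p) x = 0"
      by (simp add: pderiv_mult del: mult_pCons_left)
    then show False by (simp add: pd)
  qed
  then have "size A = card (set_mset A)"
    by (simp add: size_multiset_overloaded_eq)
  then show ?thesis using roots A(1) deg by (simp add: n_def)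
qed

lemma GF2_unique:
  fixes K :: "F2bar set"
  assumes "m \<ge> 1" "card K = 2 ^ m" "0 \<in> K" "1 \<in> K"
    and mult: "\<And>x y. x \<in> K \<Longrightarrow> y \<in> K \<Longrightarrow> x * y \<in> K"
  shows "K = GF2 m"
proof (rule card_subset_eq)
  show "finite (GF2 m)" using card_GF2[OF assms(1)] by (metis card.infinite power_not_zero zero_neq_numeral)
  show "card K = card (GF2 m)" using assms card_GF2 by simp
  have fin: "finite K" using assms(2) by (metis card.infinite power_not_zero zero_neq_numeral)
  show "K \<subseteq> GF2 m"
  proof
    fix x assume x: "x \<in> K"
    show "x \<in> GF2 m"
    proof (cases "x = 0")
      case False
      define U where "U = K - {0}"
      have U: "finite U" "card U = 2 ^ m - 1" "0 \<notin> U"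
        using fin assms(2,3) by (auto simp: U_def)
      have "(\<lambda>y. x * y) ` U = U"
        by (rule endo_inj_surj) (use False x U mult in \<open>auto simp: U_def inj_on_def\<close>)
      then have "prod id U = prod id ((\<lambda>y. x * y) ` U)" by simp
      also have "\<dots> = prod (\<lambda>y. x * y) U"
        using False by (subst prod.reindex) (auto simp: inj_on_def)
      also have "\<dots> = x ^ card U * prod id U"
        by (simp add: prod.distrib)
      finally have "x ^ (2 ^ m - 1) = 1"
        using U by (auto simp: prod_zero_iff)
      then have "x ^ Suc (2 ^ m - 1) = x" by (simp only: power_Suc mult_1_right)
      moreover have "Suc (2 ^ m - 1) = (2 ^ m :: nat)" by simp
      ultimately show ?thesis by (simp only: GF2_def mem_Collect_eq)
    qed simp
  qed
qed

definition G ::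
  "nat \<Rightarrow> 'a \<Rightarrow> 'a \<Rightarrow> 'a \<Rightarrow> 'a \<Rightarrow> 'a \<times> 'a \<times> 'a \<Rightarrow> 'a \<times> 'a \<times> 'a :: field" where
  "G q a1 a2 a3 a4 = (\<lambda>(x, y, z).
     (x ^ (q + 1) + a1 * x ^ q * z + a2 * y * z ^ q,
      x ^ q * z + y ^ (q + 1),
      a3 * x * y ^ q + a4 * y ^ q * z + z ^ (q + 1)))"

lemma G_maps_to:
  assumes a: "a1 \<in> GF2 m" "a2 \<in> GF2 m" "a3 \<in> GF2 m" "a4 \<in> GF2 m"
  shows "G q a1 a2 a3 a4 ` (GF2 m \<times> GF2 m \<times> GF2 m) \<subseteq> GF2 m \<times> GF2 m \<times> GF2 m"
proof -
  have "G q a1 a2 a3 a4 (x, y, z) \<in> GF2 m \<times> GF2 m \<times> GF2 m"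
    if "x \<in> GF2 m" "y \<in> GF2 m" "z \<in> GF2 m" for x y z
    unfolding G_def prod.case
    by (intro SigmaI GF2_add GF2_mult GF2_power a that)
  note * = this
  show ?thesis
  proof (rule image_subsetI)
    fix p assume "p \<in> GF2 m \<times> GF2 m \<times> GF2 m"
    then show "G q a1 a2 a3 a4 p \<in> GF2 m \<times> GF2 m \<times> GF2 m"
      by (elim SigmaE) (simp only: *)
  qed
qed

definition root_poly :: "nat \<Rightarrow> 'a \<Rightarrow> 'a \<Rightarrow> 'a \<Rightarrow> 'a :: field poly" where
  "root_poly q a2 a3 a4 =
     Polynomial.monom (a2 ^ (q + 1) * a3 ^ q) (q ^ 2 + q + 1)
     + Polynomial.monom (a2 ^ q * a4 ^ q) (q ^ 2 + q) + 1"

end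

theory Submission
  imports Defs
begin

text \<open>
  A root of the polynomial produces an explicit collision of \<open>G\<close>, by the following computation.

  The map \<open>G\<close> is a sum of terms \<open>u\<^sup>q v\<close> in the coordinates \<open>u\<close>, \<open>v\<close>, so
  \<open>G (v + w) - G v - G w\<close> is additive in \<open>v\<close>. In characteristic two, \<open>G (v + w) = G v\<close>
  says that this additive map takes the value \<open>G w\<close> at \<open>v\<close>.
  For \<open>w = (x, 0, 1)\<close> these are three equations for \<open>v = (x t, y, z)\<close>. The second one gives
  \<open>z = 1 + t\<^sup>q\<close> and makes the terms with \<open>a1\<close> cancel in the first one, which then gives
  \<open>y = x\<^bsup>q + 1\<^esup> (1 + t + t\<^sup>q) / a2\<close>. The third one becomes a multiple of
  \<open>a3 x\<^bsup>q\<^sup>2 + q + 1\<^esup> + a4 x\<^bsup>q\<^sup>2 + q\<^esup> + a2\<^sup>q\<close>. If \<open>x\<close> is a zero of this expression,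
  every \<open>t\<close> gives a collision, and \<open>t = 0\<close> gives the points \<open>(x, y, 0)\<close> and \<open>(0, y, 1)\<close>
  with \<open>y = x\<^bsup>q + 1\<^esup> / a2\<close> (lemma \<open>G_collision\<close>).

  The substitution \<open>x\<^sup>q = a2 T\<close> turns the \<open>q\<close>-th power of the expression into a multiple of the
  given polynomial (lemma \<open>root_imp_collision_condition\<close>), and it can be solved for \<open>x\<close>
  because the Frobenius map is bijective on the field (lemma \<open>GF2_Frobenius_root\<close>).
\<close>

lemma G_collision:
  fixes x y :: "'a :: field"
  assumes "q > 0" and "a2 * y = x ^ (q + 1)" and "a3 * x * y ^ q = a4 * y ^ q + 1"
  shows "G q a1 a2 a3 a4 (x, y, 0) = G q a1 a2 a3 a4 (0, y, 1)"
  using assms by (simp add: G_def)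

lemma GF2_power_iterate:
  assumes "x \<in> GF2 m"
  shows "x ^ (2 ^ (k * m)) = x"
proof (induction k)
  case (Suc k)
  have "x ^ (2 ^ (Suc k * m)) = (x ^ (2 ^ m)) ^ (2 ^ (k * m))"
    by (simp add: power_add power_mult)
  also have "\<dots> = x"
    using assms Suc.IH by (simp add: GF2_def)
  finally show ?case .
qed simp

text \<open>
  The Frobenius map has order dividing \<open>m\<close> on the field, so the inverse of its \<open>i\<close>-th power
  is its \<open>i (m - 1)\<close>-th power.
\<close>

lemma GF2_Frobenius_root:
  assumes "m \<ge> 1" and "c \<in> GF2 m"
  obtains x where "x \<in> GF2 m" and "x ^ (2 ^ i) = c"
proof
  show "c ^ (2 ^ (i * (m - 1))) \<in> GF2 m"
    using assms(2) by (rule GF2_power)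
  have "i * (m - 1) + i = i * m"
    using assms(1) by (cases m) simp_all
  then have "(2::nat) ^ (i * (m - 1)) * 2 ^ i = 2 ^ (i * m)"
    by (simp flip: power_add)
  then show "(c ^ (2 ^ (i * (m - 1)))) ^ (2 ^ i) = c"
    using GF2_power_iterate[OF assms(2)] by (simp flip: power_mult)
qed

lemma F2bar_add_eq_0_iff: "(u :: F2bar) + v = 0 \<longleftrightarrow> u = v"
  by (metis add_eq_0_iff2 uminus_CHAR_2[OF CHAR_F2bar])

text \<open>
  The condition on \<open>x\<close> becomes the root condition on \<open>t\<close> after raising it to the power \<open>q\<close>,
  which loses nothing because the Frobenius map is additive and injective.
\<close>

lemma root_imp_collision_condition:
  fixes x y t :: F2bar and i :: nat
  defines "q \<equiv> 2 ^ i"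
  assumes root: "poly (root_poly q a2 a3 a4) t = 0"
    and "a2 \<noteq> 0" and x: "x ^ q = a2 * t" and y: "a2 * y = x ^ (q + 1)"
  shows "a3 * x * y ^ q = a4 * y ^ q + 1"
proof -
  define b where "b = (y ^ q) ^ q"
  have b: "b = a2 ^ q * t ^ (q ^ 2 + q)"
  proof -
    have "(a2 ^ q) ^ q * b = ((a2 * y) ^ q) ^ q"
      by (simp add: b_def power_mult_distrib)
    also have "\<dots> = ((x ^ q) ^ q) ^ q * (x ^ q) ^ q"
      by (simp add: y power_mult_distrib power_commutes flip: power_mult)
    also have "\<dots> = (a2 ^ q) ^ q * (a2 ^ q * t ^ (q ^ 2 + q))"
      by (simp add: x power_mult_distrib power_add power2_eq_square mult_ac flip: power_mult)
    finally show ?thesis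
      using \<open>a2 \<noteq> 0\<close> by simp
  qed
  have frob: "(u + v) ^ q = u ^ q + v ^ q" for u v :: F2bar
    unfolding q_def by (rule F2bar_add_power)
  have "(a3 * x * y ^ q + (a4 * y ^ q + 1)) ^ q = a3 ^ q * x ^ q * b + (a4 ^ q * b + 1)"
    by (simp add: frob b_def power_mult_distrib)
  also have "\<dots> = poly (root_poly q a2 a3 a4) t"
    by (simp add: b x root_poly_def poly_monom power_add algebra_simps)
  also have "\<dots> = 0"
    by (rule root)
  finally have "a3 * x * y ^ q + (a4 * y ^ q + 1) = 0"
    by simp
  then show ?thesis
    by (simp only: F2bar_add_eq_0_iff)
qed

theorem theorem4p1:
  fixes i :: nat
  assumes "i \<ge> 1"
  shows "\<exists>M :: nat. \<forall>m :: nat. m \<ge> M \<and> odd m \<and> coprime i m \<longrightarrow>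
    (\<forall>a1 \<in> GF2 m. \<forall>a2 \<in> GF2 m. \<forall>a3 \<in> GF2 m. \<forall>a4 \<in> GF2 m.
      a2 * a3 \<noteq> 0 \<and> (\<exists>t \<in> GF2 m. poly (root_poly (2 ^ i) a2 a3 a4) t = 0) \<longrightarrow>
      \<not> bij_betw (G (2 ^ i) a1 a2 a3 a4)
          (GF2 m \<times> GF2 m \<times> GF2 m) (GF2 m \<times> GF2 m \<times> GF2 m))"
proof (intro exI[of _ 1] allI impI ballI notI)
  fix m :: nat and a1 a2 a3 a4 :: F2bar
  let ?q = "2 ^ i :: nat" and ?K = "GF2 m \<times> GF2 m \<times> GF2 m"
  assume m: "m \<ge> 1 \<and> odd m \<and> coprime i m" and a2: "a2 \<in> GF2 m"
    and "a2 * a3 \<noteq> 0 \<and> (\<exists>t \<in> GF2 m. poly (root_poly ?q a2 a3 a4) t = 0)"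
    and bij: "bij_betw (G ?q a1 a2 a3 a4) ?K ?K"
  then obtain t where t: "t \<in> GF2 m" "poly (root_poly ?q a2 a3 a4) t = 0" and "a2 \<noteq> 0"
    by auto
  obtain x where x: "x \<in> GF2 m" "x ^ ?q = a2 * t"
    using GF2_Frobenius_root m GF2_mult[OF a2 t(1)] by blast
  define y where "y = inverse a2 * x ^ (?q + 1)"
  have "y \<in> GF2 m"
    unfolding y_def by (intro GF2_mult GF2_inverse GF2_power a2 x(1))
  then have "(x, y, 0) \<in> ?K" and "(0, y, 1) \<in> ?K"
    using x(1) by simp_all
  have y: "a2 * y = x ^ (?q + 1)"
    using \<open>a2 \<noteq> 0\<close> by (simp add: y_def)
  have "G ?q a1 a2 a3 a4 (x, y, 0) = G ?q a1 a2 a3 a4 (0, y, 1)"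
    using y root_imp_collision_condition[OF t(2) \<open>a2 \<noteq> 0\<close> x(2) y]
    by (intro G_collision) simp_all
  then have "(x, y, 0) = (0, y, 1 :: F2bar)"
    using bij \<open>(x, y, 0) \<in> ?K\<close> \<open>(0, y, 1) \<in> ?K\<close> by (auto simp: bij_betw_def dest: inj_onD)
  then show False
    by simp
qed

end
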